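(* Let $G=\mathbb R^m\rtimes A$ and let $Z=X_0+\sum_{\ell=1}^m\beta_\ell X_\ell$ with $\beta_1,\dots,\beta_m\in\mathbb R$. Then the distance $d_Z$ is left-invariant and is equivalent to $d_G$, i.e. there is a constant $D\ge1$ such that $D^{-1}d_Z(x,y)\le d_G(x,y)\le D\,d_Z(x,y)$ for all $x,y\in G$.
   Context: $A=(\mathbb R_+,\cdot)$ acts on $\mathbb R^m$ by $D_a(n)=an$; $G=\mathbb R^m\rtimes A$ has product $(n,a)(n',a')=(n+an',aa')$ and identity $1_G=(0,1)$. In the Lie algebra of $G$, $X_0$ is the element with $\exp(tX_0)=(0,e^t)$, and $X_1,\dots,X_m$ are the left-invariant vector fields $X_\ell|_{(n,a)}=a\,\partial_{n_\ell}$. $d_G$ is the left-invariant Carnot–Carathéodory distance on $G$ for which $X_0,X_1,\dots,X_m$ is an orthonormal frame. For $Z$ as in the claim, $n(t)\in\mathbb R^m$ is defined by $\exp(tZ)=(n(t),e^t)$, $t\in\mathbb R$, and the $Z$-flow metric is $$d_Z((n,a),(n',a'))=d_G\big((n-n(\log a),a),(n'-n(\log a'),a')\big).$$ *)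

theory Defs
  imports "HOL-Analysis.Analysis" "HOL-Algebra.Group"
begin

definition GA :: "((real^'m) \<times> real) monoid" where
  "GA = \<lparr>carrier = {(n, a). 0 < a},
         mult = (\<lambda>(n, a) (n', a'). (n + a *\<^sub>R n', a * a')),
         one = (0, 1)\<rparr>"

lemma carrier_GA [simp]: "(n, a) \<in> carrier GA \<longleftrightarrow> 0 < a"
  by (simp add: GA_def)

lemma mult_GA [simp]: "(n, a) \<otimes>\<^bsub>GA\<^esub> (n', a') = (n + a *\<^sub>R n', a * a')"
  by (simp add: GA_def)

lemma one_GA [simp]: "\<one>\<^bsub>GA\<^esub> = (0, 1)"
  by (simp add: GA_def)

lemma group_GA: "group (GA :: ((real^'m) \<times> real) monoid)"
proof (rule groupI)
  fix x :: "(real^'m) \<times> real" assume "x \<in> carrier GA"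
  then obtain n a where x: "x = (n, a)" "0 < a" by (cases x) auto
  then show "\<exists>y\<in>carrier GA. y \<otimes>\<^bsub>GA\<^esub> x = \<one>\<^bsub>GA\<^esub>"
    by (intro bexI[of _ "(- (inverse a *\<^sub>R n), inverse a)"]) auto
qed (auto simp: GA_def algebra_simps)

text \<open>The Lie algebra is the tangent space at the identity. The value at \<open>g\<close> of the left-invariant
  vector field belonging to \<open>W\<close> is the image of \<open>W\<close> under the differential of left translation
  by \<open>g\<close>.\<close>

definition left_inv_field :: "(real^'m) \<times> real \<Rightarrow> (real^'m) \<times> real \<Rightarrow> (real^'m) \<times> real" where
  "left_inv_field W g = frechet_derivative (\<lambda>h. g \<otimes>\<^bsub>GA\<^esub> h) (at \<one>\<^bsub>GA\<^esub>) W"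

lemma left_inv_field_eq: "left_inv_field (v, s) (n, a) = (a *\<^sub>R v, a * s)"
proof -
  have "((\<lambda>h. (n, a) \<otimes>\<^bsub>GA\<^esub> h) has_derivative (\<lambda>w. (a *\<^sub>R fst w, a * snd w))) (at \<one>\<^bsub>GA\<^esub>)"
    by (auto simp: GA_def case_prod_unfold intro!: derivative_eq_intros)
  then show ?thesis
    by (simp add: left_inv_field_def frechet_derivative_at[symmetric])
qed

definition G_exp :: "(real^'m) \<times> real \<Rightarrow> (real^'m) \<times> real" where
  "G_exp W = (THE g. \<exists>\<gamma>. \<gamma> 0 = \<one>\<^bsub>GA\<^esub> \<and> \<gamma> 1 = g \<and>
     (\<forall>t. \<gamma> t \<in> carrier GA \<and> (\<gamma> has_vector_derivative left_inv_field W (\<gamma> t)) (at t)))"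

definition X0 :: "(real^'m) \<times> real" where
  "X0 = (0, 1)"

definition X :: "'m \<Rightarrow> (real^'m) \<times> real" where
  "X l = (axis l 1, 0)"

lemma left_inv_field_X: "left_inv_field (X l) (n, a) = (a *\<^sub>R axis l 1, 0)"
  by (simp add: X_def left_inv_field_eq)

lemma G_exp_eq:
  "G_exp (v, s) = ((if s = 0 then 1 else (exp s - 1) / s) *\<^sub>R v, exp s)"
proof -
  define k where "k t = (if s = 0 then t else (exp (s * t) - 1) / s)" for t :: real
  define c where "c t = (k t *\<^sub>R v, exp (s * t))" for t :: real
  have k: "(k has_real_derivative exp (s * t)) (at t)" for t
    unfolding k_def by (cases "s = 0") (auto intro!: derivative_eq_intros)
  have c: "c t \<in> carrier GA" "(c has_vector_derivative left_inv_field (v, s) (c t)) (at t)" for t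
  proof -
    have "((\<lambda>t. exp (s * t)) has_vector_derivative exp (s * t) * s) (at t)"
      by (auto intro!: derivative_eq_intros simp flip: has_real_derivative_iff_has_vector_derivative)
    moreover have "((\<lambda>t. k t *\<^sub>R v) has_vector_derivative exp (s * t) *\<^sub>R v) (at t)"
      by (rule has_vector_derivative_scaleR[OF k has_vector_derivative_const, THEN has_vector_derivative_eq_rhs]) simp
    ultimately show "(c has_vector_derivative left_inv_field (v, s) (c t)) (at t)"
      unfolding c_def left_inv_field_eq by (intro has_vector_derivative_Pair)
  qed (simp add: c_def)
  have uniq: "\<gamma> 1 = c 1"
    if g0: "\<gamma> 0 = \<one>\<^bsub>GA\<^esub>"
      and g: "\<And>t. \<gamma> t \<in> carrier GA" "\<And>t. (\<gamma> has_vector_derivative left_inv_field (v, s) (\<gamma> t)) (at t)"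
    for \<gamma>
  proof -
    have d: "(\<gamma> has_vector_derivative (snd (\<gamma> t) *\<^sub>R v, snd (\<gamma> t) * s)) (at t)" for t
      using g(2)[of t] by (metis left_inv_field_eq prod.collapse)
    have ds: "((\<lambda>t. snd (\<gamma> t)) has_real_derivative snd (\<gamma> t) * s) (at t)" for t
      using bounded_linear.has_vector_derivative[OF bounded_linear_snd d[of t]]
      by (simp add: has_real_derivative_iff_has_vector_derivative)
    have "((\<lambda>t. snd (\<gamma> t) * exp (- s * t)) has_real_derivative 0) (at t)" for t
      by (rule derivative_eq_intros ds refl | simp)+
    then have "snd (\<gamma> t) * exp (- s * t) = snd (\<gamma> 0) * exp (- s * 0)" for t
      using DERIV_isconst_all[of "\<lambda>t. snd (\<gamma> t) * exp (- s * t)" t 0] by simp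
    then have s: "snd (\<gamma> t) = exp (s * t)" for t
      using g0 exp_minus_inverse[of "s * t"] by (metis exp_minus_inverse mult.assoc mult.commute mult.left_neutral mult_minus_left mult_zero_right exp_zero one_GA snd_conv)
    have df: "((\<lambda>t. fst (\<gamma> t)) has_vector_derivative exp (s * t) *\<^sub>R v) (at t)" for t
      using bounded_linear.has_vector_derivative[OF bounded_linear_fst d[of t]] by (simp add: s)
    have "((\<lambda>t. fst (\<gamma> t) - fst (c t)) has_vector_derivative 0) (at t)" for t
      using has_vector_derivative_diff[OF df[of t]
          bounded_linear.has_vector_derivative[OF bounded_linear_fst c(2)[of t]]]
      by (simp add: c_def left_inv_field_eq)
    then have "((\<lambda>t. fst (\<gamma> t) - fst (c t)) has_derivative (\<lambda>h. 0)) (at t within UNIV)" for t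
      by (simp add: has_vector_derivative_def)
    then obtain w where w: "\<And>t. fst (\<gamma> t) - fst (c t) = w"
      using has_derivative_zero_constant[of UNIV "\<lambda>t. fst (\<gamma> t) - fst (c t)"] by auto
    have "w = 0" using w[of 0] g0 by (auto simp: c_def k_def)
    then show ?thesis using w[of 1] s[of 1] by (simp add: prod_eq_iff c_def)
  qed
  have "G_exp (v, s) = c 1"
    unfolding G_exp_def
  proof (rule the_equality)
    show "\<exists>\<gamma>. \<gamma> 0 = \<one>\<^bsub>GA\<^esub> \<and> \<gamma> 1 = c 1 \<and>
     (\<forall>t. \<gamma> t \<in> carrier GA \<and> (\<gamma> has_vector_derivative left_inv_field (v, s) (\<gamma> t)) (at t))"
      using c by (intro exI[of _ c]) (auto simp: c_def k_def)
  qed (use uniq in blast)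
  then show ?thesis by (simp add: c_def k_def)
qed

lemma G_exp_X0: "G_exp (t *\<^sub>R X0) = (0, exp t)"
  by (simp add: X0_def G_exp_eq)

definition abs_cont_on :: "real \<Rightarrow> real \<Rightarrow> (real \<Rightarrow> 'a::metric_space) \<Rightarrow> bool" where
  "abs_cont_on a b f \<longleftrightarrow> (\<forall>\<epsilon>>0. \<exists>\<delta>>0. \<forall>I :: (real \<times> real) set.
     finite I \<and> (\<forall>(s, t)\<in>I. a \<le> s \<and> s < t \<and> t \<le> b) \<and>
     pairwise (\<lambda>p q. {fst p<..<snd p} \<inter> {fst q<..<snd q} = {}) I \<and>
     (\<Sum>(s, t)\<in>I. t - s) < \<delta>
     \<longrightarrow> (\<Sum>(s, t)\<in>I. dist (f s) (f t)) < \<epsilon>)"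

text \<open>\<open>b0\<close> and \<open>b l\<close> are the coordinates of the velocity of \<open>\<gamma>\<close> in the frame \<open>X0\<close>, \<open>X l\<close>.\<close>

definition horizontal_curve ::
  "(real \<Rightarrow> (real^'m) \<times> real) \<Rightarrow> (real \<Rightarrow> real) \<Rightarrow> ('m \<Rightarrow> real \<Rightarrow> real) \<Rightarrow> bool" where
  "horizontal_curve \<gamma> b0 b \<longleftrightarrow>
     \<gamma> ` {0..1} \<subseteq> carrier GA \<and> abs_cont_on 0 1 \<gamma> \<and>
     integrable (lebesgue_on {0..1}) b0 \<and> (\<forall>l. integrable (lebesgue_on {0..1}) (b l)) \<and>
     (AE t in lebesgue_on {0..1}.
        (\<gamma> has_vector_derivative
           (b0 t *\<^sub>R left_inv_field X0 (\<gamma> t) + (\<Sum>l\<in>UNIV. b l t *\<^sub>R left_inv_field (X l) (\<gamma> t))))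
        (at t))"

definition horizontal_length :: "(real \<Rightarrow> real) \<Rightarrow> ('m::finite \<Rightarrow> real \<Rightarrow> real) \<Rightarrow> real" where
  "horizontal_length b0 b = (LINT t|lebesgue_on {0..1}. sqrt ((b0 t)\<^sup>2 + (\<Sum>l\<in>UNIV. (b l t)\<^sup>2)))"

definition horizontal_lengths :: "(real^'m) \<times> real \<Rightarrow> (real^'m) \<times> real \<Rightarrow> real set" where
  "horizontal_lengths x y =
     {horizontal_length b0 b | \<gamma> b0 b. horizontal_curve \<gamma> b0 b \<and> \<gamma> 0 = x \<and> \<gamma> 1 = y}"

definition dG :: "(real^'m) \<times> real \<Rightarrow> (real^'m) \<times> real \<Rightarrow> real" where
  "dG x y = Inf (horizontal_lengths x y)"

lemma horizontal_lengths_bdd_below: "bdd_below (horizontal_lengths x y)"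
  by (rule bdd_belowI[of _ 0])
    (auto simp: horizontal_lengths_def horizontal_length_def intro!: Bochner_Integration.integral_nonneg sum_nonneg add_nonneg_nonneg)

lemma horizontal_lengths_nonempty:
  assumes "x \<in> carrier GA" "y \<in> carrier GA"
  shows "horizontal_lengths x y \<noteq> {}"
proof -
  obtain n a n' a' where x: "x = (n, a)" and y: "y = (n', a')" and a: "0 < a" "0 < a'"
    using assms by (cases x, cases y) auto
  define \<gamma> where "\<gamma> t = x + t *\<^sub>R (y - x)" for t :: real
  define h where "h t = a + t * (a' - a)" for t :: real
  have h: "0 < h t" if "t \<in> {0..1}" for t
  proof -
    have "h t = (1 - t) * a + t * a'" by (simp add: h_def algebra_simps)
    moreover have "0 < (1 - t) * a + t * a'"
      using that a by (cases "t = 0") (auto intro!: add_nonneg_pos)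
    ultimately show ?thesis by simp
  qed
  have g: "\<gamma> t = (n + t *\<^sub>R (n' - n), h t)" for t
    by (simp add: \<gamma>_def x y h_def)
  define b0 where "b0 t = (a' - a) / h t" for t
  define b where "b l t = (n' - n) $ l / h t" for l t
  have int: "integrable (lebesgue_on {0..1}) (\<lambda>t. c / h t)" for c
  proof -
    have "continuous_on {0..1} (\<lambda>t. c / h t)"
      using h by (auto intro!: continuous_intros simp: h_def) (metis atLeastAtMost_iff less_irrefl)
    then show ?thesis by (rule continuous_imp_integrable_real)
  qed
  have "abs_cont_on 0 1 \<gamma>"
    unfolding abs_cont_on_def
  proof (intro allI impI)
    fix e :: real assume e: "0 < e"
    have "(\<Sum>(s, t)\<in>I. dist (\<gamma> s) (\<gamma> t)) < e"
      if I: "\<forall>(s, t)\<in>I. 0 \<le> s \<and> s < t \<and> t \<le> 1" "(\<Sum>(s, t)\<in>I. t - s) < e / (norm (y - x) + 1)"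
      for I :: "(real \<times> real) set"
    proof -
      have d: "dist (\<gamma> s) (\<gamma> t) = (t - s) * norm (y - x)" if "s < t" for s t
      proof -
        have "\<gamma> s - \<gamma> t = (s - t) *\<^sub>R (y - x)" by (simp add: \<gamma>_def scaleR_left_diff_distrib)
        then show ?thesis using that by (simp add: dist_norm)
      qed
      have "(\<Sum>(s, t)\<in>I. dist (\<gamma> s) (\<gamma> t)) = (\<Sum>(s, t)\<in>I. (t - s) * norm (y - x))"
        using I(1) by (intro sum.cong) (auto simp: d)
      also have "\<dots> = (\<Sum>(s, t)\<in>I. t - s) * norm (y - x)"
        by (simp add: sum_distrib_right case_prod_unfold)
      also have "\<dots> \<le> (\<Sum>(s, t)\<in>I. t - s) * (norm (y - x) + 1)"
        using I(1) by (intro mult_left_mono sum_nonneg) auto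
      also have "\<dots> < e"
        using I(2) by (simp add: pos_less_divide_eq add_nonneg_pos)
      finally show ?thesis .
    qed
    then show "\<exists>d>0. \<forall>I. finite I \<and> (\<forall>(s, t)\<in>I. 0 \<le> s \<and> s < t \<and> t \<le> 1) \<and>
        pairwise (\<lambda>p q. {fst p<..<snd p} \<inter> {fst q<..<snd q} = {}) I \<and>
        (\<Sum>(s, t)\<in>I. t - s) < d \<longrightarrow> (\<Sum>(s, t)\<in>I. dist (\<gamma> s) (\<gamma> t)) < e"
      using e by (intro exI[of _ "e / (norm (y - x) + 1)"]) (auto simp: add_nonneg_pos)
  qed
  moreover have "(\<gamma> has_vector_derivative
      (b0 t *\<^sub>R left_inv_field X0 (\<gamma> t) + (\<Sum>l\<in>UNIV. b l t *\<^sub>R left_inv_field (X l) (\<gamma> t)))) (at t)"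
    if "t \<in> {0..1}" for t
  proof -
    have "(\<Sum>l\<in>UNIV. b l t *\<^sub>R left_inv_field (X l) (\<gamma> t)) = (\<Sum>l\<in>UNIV. ((n' - n) $ l *\<^sub>R axis l 1, 0))"
      using h[OF that] by (simp add: left_inv_field_X b_def g)
    also have "\<dots> = (\<Sum>l\<in>UNIV. (n' - n) $ l *\<^sub>R axis l 1, 0)"
      by (simp add: prod_eq_iff fst_sum snd_sum)
    also have "\<dots> = (n' - n, 0)"
      using basis_expansion[of "n' - n"] by (simp add: scalar_mult_eq_scaleR)
    finally have "b0 t *\<^sub>R left_inv_field X0 (\<gamma> t) + (\<Sum>l\<in>UNIV. b l t *\<^sub>R left_inv_field (X l) (\<gamma> t)) = y - x"
      using h[OF that] by (simp add: g X0_def left_inv_field_eq b0_def x y)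
    then show ?thesis
      unfolding \<gamma>_def by (auto intro!: derivative_eq_intros)
  qed
  ultimately have "horizontal_curve \<gamma> b0 b"
    using h int[of "a' - a", folded b0_def] int[of "(n' - n) $ l" for l, folded b_def]
    by (auto simp: horizontal_curve_def g intro!: AE_I2)
  moreover have "\<gamma> 0 = x" "\<gamma> 1 = y" by (simp_all add: \<gamma>_def)
  ultimately show ?thesis unfolding horizontal_lengths_def by blast
qed

definition flow_n :: "(real^'m) \<times> real \<Rightarrow> real \<Rightarrow> real^'m" where
  "flow_n Z t = (THE v. G_exp (t *\<^sub>R Z) = (v, exp t))"

lemma G_exp_flow_n:
  assumes "Z = X0 + (\<Sum>l\<in>UNIV. \<beta> l *\<^sub>R X l)"
  shows "G_exp (t *\<^sub>R Z) = (flow_n Z t, exp t)"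
proof -
  have "snd Z = 1" by (simp add: assms X0_def X_def snd_sum)
  then have "snd (t *\<^sub>R Z) = t" by simp
  then obtain v where "t *\<^sub>R Z = (v, t)" by (metis prod.collapse)
  then show ?thesis by (auto simp: flow_n_def G_exp_eq)
qed

definition dZ :: "(real^'m) \<times> real \<Rightarrow> (real^'m) \<times> real \<Rightarrow> (real^'m) \<times> real \<Rightarrow> real" where
  "dZ Z = (\<lambda>(n, a) (n', a'). dG (n - flow_n Z (ln a), a) (n' - flow_n Z (ln a'), a'))"

end

(* In coordinates n(t) = (e^t - 1) \<beta>, so d_Z is the pullback of d_G under the affine automorphism
   (n, a) \<mapsto> (n - (a - 1) \<beta>, a) of G.  Left translations and this automorphism both belong to the
   family of affine bijections (n, a) \<mapsto> (p + q (n + a c), q a) with q > 0.  Such a map carries a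
   horizontal curve with velocity (b0, b) to one with velocity (b0, b + b0 c), so it stretches d_G by
   a factor at most 1 + |c|, and its inverse lies in the family with parameter -c. *)

theory Submission
  imports Defs
begin

text \<open>This is left translation by \<open>(p, q)\<close> applied after \<open>(n, a)\<close>
  \<mapsto> \<open>(n + a c, a)\<close>. Taking \<open>c = 0\<close> gives all left translations, so
  one distortion estimate serves both halves of the theorem.\<close>

definition shear :: "real^'m \<Rightarrow> real \<Rightarrow> real^'m \<Rightarrow> (real^'m) \<times> real \<Rightarrow> (real^'m) \<times> real" where
  "shear p q c = (\<lambda>(n, a). (p + q *\<^sub>R (n + a *\<^sub>R c), q * a))"

lemma shear_Pair [simp]: "shear p q c (n, a) = (p + q *\<^sub>R (n + a *\<^sub>R c), q * a)"
  by (simp add: shear_def)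

lemma shear_in_carrier: "0 < q \<Longrightarrow> x \<in> carrier GA \<Longrightarrow> shear p q c x \<in> carrier GA"
  by (cases x) simp

text \<open>The inverse stays in the family and its third parameter has the same norm as
  \<open>c\<close>, so every upper bound on distortion yields a lower bound with the same
  constant.\<close>

lemma shear_inverse:
  assumes "q \<noteq> 0"
  shows "shear (- (inverse q *\<^sub>R p)) (inverse q) (- c) (shear p q c x) = x"
  using assms by (cases x) (simp add: algebra_simps)

lemma shear_has_derivative:
  assumes "(\<gamma> has_vector_derivative (v, s)) (at t)"
  shows "((\<lambda>t. shear p q c (\<gamma> t)) has_vector_derivative (q *\<^sub>R (v + s *\<^sub>R c), q * s)) (at t)"
  unfolding shear_def case_prod_unfold has_vector_derivative_def
  by (rule derivative_eq_intros assms[unfolded has_vector_derivative_def] refl)+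
    (simp add: fun_eq_iff algebra_simps)

text \<open>Absolute continuity is measured in the product metric \<open>dist\<close>, not in
  \<open>dG\<close>, so a crude Lipschitz constant for that metric suffices to preserve it.\<close>

lemma shear_dist_le: "dist (shear p q c x) (shear p q c y) \<le> \<bar>q\<bar> * (2 + norm c) * dist x y"
proof -
  obtain n a n' a' where xy: "x = (n, a)" "y = (n', a')" by (cases x, cases y) auto
  define d where "d = x - y"
  have f: "norm (n - n') \<le> norm d" "\<bar>a - a'\<bar> \<le> norm d"
    using norm_fst_le[of "n - n'" "a - a'"] norm_snd_le[of "a - a'" "n - n'"] by (simp_all add: d_def xy)
  have "shear p q c x - shear p q c y = q *\<^sub>R ((n - n') + (a - a') *\<^sub>R c, a - a')"
    by (simp add: xy algebra_simps)
  then have "dist (shear p q c x) (shear p q c y) = \<bar>q\<bar> * norm ((n - n') + (a - a') *\<^sub>R c, a - a')"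
    by (simp only: dist_norm norm_scaleR)
  also have "norm ((n - n') + (a - a') *\<^sub>R c, a - a') \<le> norm ((n - n') + (a - a') *\<^sub>R c) + \<bar>a - a'\<bar>"
    using norm_Pair_le[of "(n - n') + (a - a') *\<^sub>R c" "a - a'"] by simp
  also have "\<dots> \<le> norm (n - n') + \<bar>a - a'\<bar> * norm c + \<bar>a - a'\<bar>"
    using norm_triangle_ineq[of "n - n'" "(a - a') *\<^sub>R c"] by simp
  also have "\<dots> \<le> norm d + norm d * norm c + norm d"
    using f by (intro add_mono mult_right_mono) auto
  also have "\<dots> = (2 + norm c) * dist x y"
    by (simp add: d_def dist_norm algebra_simps)
  finally show ?thesis by (simp add: mult_left_mono mult.assoc)
qed

lemma abs_cont_on_lipschitz_compose:
  assumes "abs_cont_on a b \<gamma>" and lip: "\<And>x y. dist (f x) (f y) \<le> L * dist x y" and "0 < L"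
  shows "abs_cont_on a b (\<lambda>t. f (\<gamma> t))"
  unfolding abs_cont_on_def
proof (intro allI impI)
  fix e :: real assume "0 < e"
  then have "0 < e / L" using \<open>0 < L\<close> by simp
  then obtain d where "d > 0" and d: "\<And>I. finite I \<and> (\<forall>(s, t)\<in>I. a \<le> s \<and> s < t \<and> t \<le> b) \<and>
     pairwise (\<lambda>p q. {fst p<..<snd p} \<inter> {fst q<..<snd q} = {}) I \<and>
     (\<Sum>(s, t)\<in>I. t - s) < d \<Longrightarrow> (\<Sum>(s, t)\<in>I. dist (\<gamma> s) (\<gamma> t)) < e / L"
    using assms(1) unfolding abs_cont_on_def by blast
  have "(\<Sum>(s, t)\<in>I. dist (f (\<gamma> s)) (f (\<gamma> t))) < e"
    if "(\<Sum>(s, t)\<in>I. dist (\<gamma> s) (\<gamma> t)) < e / L" for I :: "(real \<times> real) set"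
  proof -
    have "(\<Sum>(s, t)\<in>I. dist (f (\<gamma> s)) (f (\<gamma> t))) \<le> (\<Sum>(s, t)\<in>I. L * dist (\<gamma> s) (\<gamma> t))"
      by (intro sum_mono) (auto simp: lip)
    also have "\<dots> = L * (\<Sum>(s, t)\<in>I. dist (\<gamma> s) (\<gamma> t))"
      by (simp add: sum_distrib_left case_prod_unfold)
    also have "\<dots> < e"
      using that \<open>0 < L\<close> by (simp add: pos_less_divide_eq mult.commute)
    finally show ?thesis .
  qed
  with \<open>d > 0\<close> d show "\<exists>d>0. \<forall>I. finite I \<and> (\<forall>(s, t)\<in>I. a \<le> s \<and> s < t \<and> t \<le> b) \<and>
     pairwise (\<lambda>p q. {fst p<..<snd p} \<inter> {fst q<..<snd q} = {}) I \<and>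
     (\<Sum>(s, t)\<in>I. t - s) < d \<longrightarrow> (\<Sum>(s, t)\<in>I. dist (f (\<gamma> s)) (f (\<gamma> t))) < e"
    by blast
qed

text \<open>At height \<open>a\<close> the frame is the standard basis scaled by \<open>a\<close>.
  This turns frame coordinates into an ordinary velocity, so that velocities at different points can
  be compared.\<close>

lemma frame_combination:
  fixes b :: "'m::finite \<Rightarrow> real"
  shows "b0 *\<^sub>R left_inv_field X0 (n, a) + (\<Sum>l\<in>UNIV. b l *\<^sub>R left_inv_field (X l) (n, a))
    = (a *\<^sub>R (\<chi> l. b l), a * b0)"
proof -
  have "(\<Sum>l\<in>UNIV. b l *\<^sub>R left_inv_field (X l) (n, a)) = (a *\<^sub>R (\<Sum>l\<in>UNIV. b l *\<^sub>R axis l 1), 0)"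
    by (simp add: left_inv_field_X prod_eq_iff fst_sum snd_sum scaleR_sum_right mult.commute)
  also have "(\<Sum>l\<in>UNIV. b l *\<^sub>R axis l 1) = (\<chi> l. b l)"
    using basis_expansion[of "\<chi> l. b l"] by (simp add: scalar_mult_eq_scaleR)
  finally show ?thesis by (simp add: X0_def left_inv_field_eq)
qed

lemma horizontal_curve_shear:
  fixes b :: "'m::finite \<Rightarrow> real \<Rightarrow> real"
  assumes h: "horizontal_curve \<gamma> b0 b" and q: "0 < q"
  shows "horizontal_curve (\<lambda>t. shear p q c (\<gamma> t)) b0 (\<lambda>l t. b l t + b0 t * c $ l)"
proof -
  have "((\<lambda>t. shear p q c (\<gamma> t)) has_vector_derivative
         (b0 t *\<^sub>R left_inv_field X0 (shear p q c (\<gamma> t)) +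
          (\<Sum>l\<in>UNIV. (b l t + b0 t * c $ l) *\<^sub>R left_inv_field (X l) (shear p q c (\<gamma> t))))) (at t)"
    if "(\<gamma> has_vector_derivative (b0 t *\<^sub>R left_inv_field X0 (\<gamma> t) +
           (\<Sum>l\<in>UNIV. b l t *\<^sub>R left_inv_field (X l) (\<gamma> t)))) (at t)" for t
  proof -
    obtain n a where g: "\<gamma> t = (n, a)" by (cases "\<gamma> t")
    have "(\<gamma> has_vector_derivative (a *\<^sub>R (\<chi> l. b l t), a * b0 t)) (at t)"
      using that by (simp only: g frame_combination)
    note shear_has_derivative[OF this, of p q c]
    \<comment> \<open>The factor \<open>q * a\<close> is the height of the image point and is
      absorbed by the frame there. What remains are the new coordinates, free of \<open>p\<close>
      and \<open>q\<close>.\<close>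
    moreover have "q *\<^sub>R (a *\<^sub>R (\<chi> l. b l t) + (a * b0 t) *\<^sub>R c)
        = (q * a) *\<^sub>R (\<chi> l. b l t + b0 t * c $ l)"
      by (simp add: vec_eq_iff algebra_simps)
    ultimately show ?thesis
      by (simp only: g shear_Pair frame_combination mult.assoc)
  qed
  moreover have "abs_cont_on 0 1 (\<lambda>t. shear p q c (\<gamma> t))"
    using h q by (intro abs_cont_on_lipschitz_compose[OF _ shear_dist_le])
      (auto simp: horizontal_curve_def intro!: mult_pos_pos add_pos_nonneg)
  ultimately show ?thesis
    using h q unfolding horizontal_curve_def
    by (auto simp: image_subset_iff intro!: shear_in_carrier elim!: eventually_mono)
qed

text \<open>The new coordinate vector is the old one plus \<open>(0, s c)\<close>. The triangle
  inequality applies, and \<bar>s\<bar> is at most the norm of the old vector.\<close>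

lemma sqrt_sum_squares_shear_le:
  fixes b :: "'m::finite \<Rightarrow> real" and c :: "real^'m"
  shows "sqrt (s\<^sup>2 + (\<Sum>l\<in>UNIV. (b l + s * c $ l)\<^sup>2)) \<le> (1 + norm c) * sqrt (s\<^sup>2 + (\<Sum>l\<in>UNIV. (b l)\<^sup>2))"
proof -
  have eq: "sqrt (s\<^sup>2 + (\<Sum>l\<in>UNIV. (v l)\<^sup>2)) = norm (s, \<chi> l. v l)" for v :: "'m \<Rightarrow> real"
    by (simp add: norm_Pair norm_vec_def L2_set_def sum_nonneg)
  have split: "(s, \<chi> l. b l + s * c $ l) = (s, \<chi> l. b l) + (0, s *\<^sub>R c)"
    by (simp add: vec_eq_iff)
  have "norm (s, \<chi> l. b l + s * c $ l) \<le> norm (s, \<chi> l. b l) + norm (0 :: real, s *\<^sub>R c)"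
    unfolding split by (rule norm_triangle_ineq)
  also have "norm (0 :: real, s *\<^sub>R c) = \<bar>s\<bar> * norm c" by (simp add: norm_Pair)
  also have "\<bar>s\<bar> * norm c \<le> norm (s, \<chi> l. b l) * norm c"
    using norm_fst_le[of s "\<chi> l. b l"] by (intro mult_right_mono) auto
  finally show ?thesis unfolding eq by (simp add: algebra_simps)
qed

text \<open>Comparing lengths by monotonicity of the integral requires both speeds to be integrable.
  The Euclidean norm of the coordinates is dominated by the sum of their absolute values.\<close>

lemma horizontal_speed_integrable:
  fixes b :: "'m::finite \<Rightarrow> real \<Rightarrow> real"
  assumes "integrable M b0" "\<And>l. integrable M (b l)"
  shows "integrable M (\<lambda>t. sqrt ((b0 t)\<^sup>2 + (\<Sum>l\<in>UNIV. (b l t)\<^sup>2)))"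
proof (rule Bochner_Integration.integrable_bound)
  show "integrable M (\<lambda>t. \<bar>b0 t\<bar> + (\<Sum>l\<in>UNIV. \<bar>b l t\<bar>))"
    using assms by auto
  show "(\<lambda>t. sqrt ((b0 t)\<^sup>2 + (\<Sum>l\<in>UNIV. (b l t)\<^sup>2))) \<in> borel_measurable M"
    using assms[THEN borel_measurable_integrable] by measurable
  have "sqrt ((b0 t)\<^sup>2 + (\<Sum>l\<in>UNIV. (b l t)\<^sup>2)) \<le> \<bar>b0 t\<bar> + (\<Sum>l\<in>UNIV. \<bar>b l t\<bar>)" for t
  proof -
    have "sqrt ((b0 t)\<^sup>2 + (\<Sum>l\<in>UNIV. (b l t)\<^sup>2)) \<le> sqrt ((b0 t)\<^sup>2) + sqrt (\<Sum>l\<in>UNIV. (b l t)\<^sup>2)"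
      by (intro sqrt_add_le_add_sqrt sum_nonneg) auto
    also have "sqrt (\<Sum>l\<in>UNIV. (b l t)\<^sup>2) \<le> (\<Sum>l\<in>UNIV. \<bar>b l t\<bar>)"
      using L2_set_le_sum_abs[of "\<lambda>l. b l t" UNIV] by (simp add: L2_set_def)
    finally show ?thesis by simp
  qed
  then show "AE t in M. norm (sqrt ((b0 t)\<^sup>2 + (\<Sum>l\<in>UNIV. (b l t)\<^sup>2)))
      \<le> norm (\<bar>b0 t\<bar> + (\<Sum>l\<in>UNIV. \<bar>b l t\<bar>))"
    by (intro AE_I2) (auto simp: sum_nonneg)
qed

lemma horizontal_length_shear_le:
  assumes "integrable (lebesgue_on {0..1}) b0" "\<And>l. integrable (lebesgue_on {0..1}) (b l)"
  shows "horizontal_length b0 (\<lambda>l t. b l t + b0 t * c $ l) \<le> (1 + norm c) * horizontal_length b0 b"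
proof -
  have "horizontal_length b0 (\<lambda>l t. b l t + b0 t * c $ l)
      \<le> (LINT t|lebesgue_on {0..1}. (1 + norm c) * sqrt ((b0 t)\<^sup>2 + (\<Sum>l\<in>UNIV. (b l t)\<^sup>2)))"
    unfolding horizontal_length_def using assms
    by (intro integral_mono sqrt_sum_squares_shear_le horizontal_speed_integrable
        integrable_mult_right) auto
  then show ?thesis by (simp add: horizontal_length_def)
qed

text \<open>Each horizontal curve from \<open>x\<close> to \<open>y\<close> is carried to one
  joining the images, with length multiplied by at most \<open>1 + norm c\<close>. The bound passes
  to the infimum.\<close>

lemma dG_shear_le:
  fixes x y :: "(real^'m::finite) \<times> real"
  assumes "x \<in> carrier GA" "y \<in> carrier GA" "0 < q"
  shows "dG (shear p q c x) (shear p q c y) \<le> (1 + norm c) * dG x y"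
proof -
  have K: "0 < 1 + norm c" by (simp add: add_pos_nonneg)
  \<comment> \<open>Dividing by the positive factor gives a lower bound for all lengths between
    \<open>x\<close> and \<open>y\<close>, the form needed for comparison with their
    infimum.\<close>
  have "dG (shear p q c x) (shear p q c y) / (1 + norm c) \<le> h" if mem: "h \<in> horizontal_lengths x y" for h
  proof -
    obtain \<gamma> b0 b where h: "h = horizontal_length b0 b" "horizontal_curve \<gamma> b0 b" "\<gamma> 0 = x" "\<gamma> 1 = y"
      using mem unfolding horizontal_lengths_def by blast
    have "horizontal_length b0 (\<lambda>l t. b l t + b0 t * c $ l)
        \<in> horizontal_lengths (shear p q c x) (shear p q c y)"
      using horizontal_curve_shear[OF h(2) \<open>0 < q\<close>, of p c] h(3,4)
      unfolding horizontal_lengths_def by blast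
    then have "dG (shear p q c x) (shear p q c y) \<le> horizontal_length b0 (\<lambda>l t. b l t + b0 t * c $ l)"
      unfolding dG_def by (rule cInf_lower[OF _ horizontal_lengths_bdd_below])
    also have "\<dots> \<le> (1 + norm c) * h"
      using h(2) unfolding h(1) by (intro horizontal_length_shear_le) (auto simp: horizontal_curve_def)
    finally show ?thesis using K by (simp add: pos_divide_le_eq mult.commute)
  qed
  then have "dG (shear p q c x) (shear p q c y) / (1 + norm c) \<le> dG x y"
    unfolding dG_def[of x y] using horizontal_lengths_nonempty[OF assms(1,2)] by (intro cInf_greatest)
  then show ?thesis using K by (simp add: pos_divide_le_eq mult.commute)
qed

text \<open>The preceding estimate is applied to the inverse map, whose parameter \<open>- c\<close>
  has the same norm.\<close>

lemma dG_le_shear: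
  fixes x y :: "(real^'m::finite) \<times> real"
  assumes "x \<in> carrier GA" "y \<in> carrier GA" "0 < q"
  shows "dG x y \<le> (1 + norm c) * dG (shear p q c x) (shear p q c y)"
  using dG_shear_le[of "shear p q c x" "shear p q c y" "inverse q" "- (inverse q *\<^sub>R p)" "- c"] assms
  by (simp add: shear_inverse shear_in_carrier)

text \<open>For \<open>c = 0\<close> the distortion factor is 1 in both directions.\<close>

lemma dG_left_invariant:
  fixes x y :: "(real^'m::finite) \<times> real"
  assumes "g \<in> carrier GA" "x \<in> carrier GA" "y \<in> carrier GA"
  shows "dG (g \<otimes>\<^bsub>GA\<^esub> x) (g \<otimes>\<^bsub>GA\<^esub> y) = dG x y"
proof -
  obtain p q where g: "g = (p, q)" "0 < q" using assms(1) by (cases g) auto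
  have "g \<otimes>\<^bsub>GA\<^esub> z = shear p q 0 z" for z by (cases z) (simp add: g)
  then show ?thesis
    using dG_shear_le[OF assms(2,3) g(2), of p 0] dG_le_shear[OF assms(2,3) g(2), of 0 p] by simp
qed

lemma flow_n_eq:
  fixes \<beta> :: "'m::finite \<Rightarrow> real"
  assumes "Z = X0 + (\<Sum>l\<in>UNIV. \<beta> l *\<^sub>R X l)"
  shows "flow_n Z t = (exp t - 1) *\<^sub>R (\<chi> l. \<beta> l)"
proof -
  have "(\<Sum>l\<in>UNIV. \<beta> l *\<^sub>R axis l 1) = (\<chi> l. \<beta> l)"
    using basis_expansion[of "\<chi> l. \<beta> l"] by (simp add: scalar_mult_eq_scaleR)
  then have "t *\<^sub>R Z = (t *\<^sub>R (\<chi> l. \<beta> l), t)"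
    by (simp add: assms X0_def X_def prod_eq_iff fst_sum snd_sum)
  \<comment> \<open>For nonzero \<open>t\<close> the factor \<open>(exp t - 1) / t\<close> in the
    exponential cancels the \<open>t\<close> in \<open>t *\<^sub>R Z\<close>; at
    \<open>t = 0\<close> both sides vanish.\<close>
  then show ?thesis
    using G_exp_flow_n[OF assms, of t] by (auto simp: G_exp_eq split: if_splits)
qed

text \<open>The map is conjugation by \<open>(v, 1)\<close>: the product of \<open>(v, 1)\<close>,
  \<open>(n, a)\<close> and \<open>(- v, 1)\<close> is \<open>(v + n - a v, a)\<close>.\<close>

lemma shear_hom:
  "shear v 1 (- v) (g \<otimes>\<^bsub>GA\<^esub> x) = shear v 1 (- v) g \<otimes>\<^bsub>GA\<^esub> shear v 1 (- v) x"
  by (cases g; cases x) (simp add: algebra_simps)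

theorem proposition6p3:
  fixes \<beta> :: "'m::finite \<Rightarrow> real" and Z :: "(real^'m) \<times> real"
  assumes "Z = X0 + (\<Sum>l\<in>UNIV. \<beta> l *\<^sub>R X l)"
  shows "(\<forall>g\<in>carrier GA. \<forall>x\<in>carrier GA. \<forall>y\<in>carrier GA.
            dZ Z (g \<otimes>\<^bsub>GA\<^esub> x) (g \<otimes>\<^bsub>GA\<^esub> y) = dZ Z x y) \<and>
         (\<exists>D::real. D \<ge> 1 \<and> (\<forall>x\<in>carrier GA. \<forall>y\<in>carrier GA.
            inverse D * dZ Z x y \<le> dG x y \<and> dG x y \<le> D * dZ Z x y))"
proof -
  define v where "v = (\<chi> l. \<beta> l)"
  let ?\<Phi> = "shear v 1 (- v)"
  \<comment> \<open>Since \<open>a > 0\<close>, \<open>exp (ln a) = a\<close>, so the flow shift at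
    height \<open>a\<close> is \<open>(a - 1) v\<close>; subtracting it from \<open>n\<close> gives
    \<open>v + n - a v\<close>.\<close>
  have dZ: "dZ Z x y = dG (?\<Phi> x) (?\<Phi> y)" if "x \<in> carrier GA" "y \<in> carrier GA" for x y
    using that by (cases x; cases y) (simp add: dZ_def flow_n_eq[OF assms] v_def algebra_simps)
  have closed: "g \<otimes>\<^bsub>GA\<^esub> x \<in> carrier GA" if "g \<in> carrier GA" "x \<in> carrier GA" for g x :: "(real^'m) \<times> real"
    using monoid.m_closed[OF group.is_monoid[OF group_GA] that] .
  have "dZ Z (g \<otimes>\<^bsub>GA\<^esub> x) (g \<otimes>\<^bsub>GA\<^esub> y) = dZ Z x y"
    if "g \<in> carrier GA" "x \<in> carrier GA" "y \<in> carrier GA" for g x y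
    \<comment> \<open>The automorphism turns translation by \<open>g\<close> into translation by the
      image of \<open>g\<close>, which \<open>dG\<close> does not see.\<close>
    using that by (simp add: dZ closed shear_hom dG_left_invariant shear_in_carrier)
  moreover have "inverse (1 + norm v) * dZ Z x y \<le> dG x y" "dG x y \<le> (1 + norm v) * dZ Z x y"
    if "x \<in> carrier GA" "y \<in> carrier GA" for x y
  proof -
    have "0 < 1 + norm v" by (simp add: add_pos_nonneg)
    then show "inverse (1 + norm v) * dZ Z x y \<le> dG x y"
      using dG_shear_le[OF that, of 1 v "- v"]
      by (simp add: dZ[OF that] field_simps)
    show "dG x y \<le> (1 + norm v) * dZ Z x y"
      using dG_le_shear[OF that, of 1 "- v" v] by (simp add: dZ[OF that])
  qed
  \<comment> \<open>The constant is the distortion factor for \<open>c = - v\<close>, and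
    \<open>norm (- v) = norm v\<close>.\<close>
  ultimately show ?thesis by (intro conjI exI[of _ "1 + norm v"]) auto
qed

end
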